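(* Let $f:X\to X$ be a continuous map on a compact metric space with finite topological entropy such that $\mu\mapsto h_\mu(f)$ is upper semi-continuous on $\mathcal{M}$, and let $m\in\mathbb{N}$. Then the global entropy function $(\Phi,w)\mapsto\mathcal{H}_\Phi(w)$ is continuous on $$\bigcup_{\Phi\in C(X,\mathbb{R}^m)}\{\Phi\}\times\operatorname{int}\mathrm{Rot}(\Phi)\subset C(X,\mathbb{R}^m)\times\mathbb{R}^m .$$
   Context: $\mathcal{M}$ is the set of $f$-invariant Borel probability measures on $X$ with the weak$^*$ topology, and $h_\mu(f)$ is the measure-theoretic entropy. For $\Phi=(\Phi_1,\dots,\Phi_m)\in C(X,\mathbb{R}^m)$, $\mathrm{rv}_\Phi(\mu)=(\int\Phi_1\,d\mu,\dots,\int\Phi_m\,d\mu)$, the rotation set is $\mathrm{Rot}(\Phi)=\{\mathrm{rv}_\Phi(\mu):\mu\in\mathcal{M}\}$, and for $w\in\mathrm{Rot}(\Phi)$ the localized entropy is $\mathcal{H}_\Phi(w)=\sup\{h_\mu(f):\mu\in\mathcal{M},\ \mathrm{rv}_\Phi(\mu)=w\}$. The interior $\operatorname{int}$ is taken in $\mathbb{R}^m$. The space $C(X,\mathbb{R}^m)\times\mathbb{R}^m$ carries the metric given by the sum of the supremum-norm distance on $C(X,\mathbb{R}^m)$ and the Euclidean distance on $\mathbb{R}^m$. *)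

theory Defs
  imports "HOL-Probability.Probability"
begin

text \<open>The space \<open>X\<close> is a type of class \<open>metric_space\<close> whose universe is assumed
  compact in the theorem. Then every continuous function on \<open>X\<close> is bounded, so
  \<open>'a \<Rightarrow>\<^sub>C (real ^ 'm)\<close> is \<open>C(X, \<real>\<^sup>m)\<close> with the supremum-norm distance.\<close>

definition invariant_measures :: "('a::topological_space \<Rightarrow> 'a) \<Rightarrow> 'a measure set" where
  "invariant_measures f = {\<mu>. prob_space \<mu> \<and> sets \<mu> = sets borel \<and> distr \<mu> borel f = \<mu>}"

text \<open>The coarsest topology on the invariant measures for which
  \<open>\<mu> \<mapsto> \<integral>\<phi> d\<mu>\<close> is continuous for every \<open>\<phi> \<in> C(X, \<real>)\<close>.\<close>

definition weak_star_topology :: "('a::topological_space \<Rightarrow> 'a) \<Rightarrow> 'a measure topology" where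
  "weak_star_topology f =
     pullback_topology (invariant_measures f)
       (\<lambda>\<mu> (\<phi> :: 'a \<Rightarrow>\<^sub>C real). \<integral>x. apply_bcontfun \<phi> x \<partial>\<mu>)
       (product_topology (\<lambda>_. euclideanreal) UNIV)"

definition upper_semicontinuous_map :: "'b topology \<Rightarrow> ('b \<Rightarrow> ereal) \<Rightarrow> bool" where
  "upper_semicontinuous_map T h \<longleftrightarrow> (\<forall>c. openin T {x \<in> topspace T. h x < c})"

definition finite_measurable_partitions :: "'a measure \<Rightarrow> 'a set set set" where
  "finite_measurable_partitions \<mu> =
     {\<xi>. finite \<xi> \<and> \<xi> \<subseteq> sets \<mu> \<and> partition_on (space \<mu>) \<xi>}"

text \<open>The convention \<open>0 log 0 = 0\<close> holds because \<open>ln 0 = 0\<close>.\<close>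

definition partition_entropy :: "'a measure \<Rightarrow> 'a set set \<Rightarrow> real" where
  "partition_entropy \<mu> \<xi> = - (\<Sum>A\<in>\<xi>. measure \<mu> A * ln (measure \<mu> A))"

definition partition_join :: "'a set set \<Rightarrow> 'a set set \<Rightarrow> 'a set set" where
  "partition_join \<xi> \<eta> = {A \<inter> B | A B. A \<in> \<xi> \<and> B \<in> \<eta>} - {{}}"

definition partition_preimage :: "('a \<Rightarrow> 'a) \<Rightarrow> 'a set set \<Rightarrow> 'a set set" where
  "partition_preimage g \<xi> = (\<lambda>A. g -` A) ` \<xi> - {{}}"

text \<open>\<open>iterated_partition f \<xi> n\<close> is the join of \<open>f\<^sup>-\<^sup>i \<xi>\<close> over \<open>0 \<le> i < n\<close>.\<close>

primrec iterated_partition :: "('a \<Rightarrow> 'a) \<Rightarrow> 'a set set \<Rightarrow> nat \<Rightarrow> 'a set set" where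
  "iterated_partition f \<xi> 0 = {UNIV}"
| "iterated_partition f \<xi> (Suc n) =
     partition_join (iterated_partition f \<xi> n) (partition_preimage (f ^^ n) \<xi>)"

text \<open>For invariant \<open>\<mu>\<close> the sequence is subadditive, hence the limit exists.\<close>

definition entropy_wrt_partition :: "('a \<Rightarrow> 'a) \<Rightarrow> 'a measure \<Rightarrow> 'a set set \<Rightarrow> real" where
  "entropy_wrt_partition f \<mu> \<xi> =
     lim (\<lambda>n. partition_entropy \<mu> (iterated_partition f \<xi> n) / real n)"

definition measure_entropy :: "('a \<Rightarrow> 'a) \<Rightarrow> 'a measure \<Rightarrow> ereal" where
  "measure_entropy f \<mu> =
     (SUP \<xi>\<in>finite_measurable_partitions \<mu>. ereal (entropy_wrt_partition f \<mu> \<xi>))"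

text \<open>Finite \<open>(n, \<epsilon>)\<close>-separated sets: distinct points are more than \<open>\<epsilon>\<close> apart in the
  Bowen metric \<open>max {dist (f\<^sup>i x) (f\<^sup>i y) | i < n}\<close>.\<close>

definition separated_sets :: "('a::metric_space \<Rightarrow> 'a) \<Rightarrow> nat \<Rightarrow> real \<Rightarrow> 'a set set" where
  "separated_sets f n \<epsilon> =
     {E. finite E \<and>
         (\<forall>x\<in>E. \<forall>y\<in>E. x \<noteq> y \<longrightarrow> (\<exists>i<n. \<epsilon> < dist ((f ^^ i) x) ((f ^^ i) y)))}"

text \<open>The inner limsup is nonincreasing in \<open>\<epsilon>\<close>, so the limit as \<open>\<epsilon>\<close> tends to \<open>0\<close> from
  above exists in the extended reals.\<close>

definition topological_entropy :: "('a::metric_space \<Rightarrow> 'a) \<Rightarrow> ereal" where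
  "topological_entropy f =
     Lim (at_right (0::real))
       (\<lambda>\<epsilon>. limsup (\<lambda>n. SUP E\<in>separated_sets f n \<epsilon>. ereal (ln (real (card E)) / real n)))"

definition rv :: "('a::topological_space \<Rightarrow>\<^sub>C (real ^ 'm)) \<Rightarrow> 'a measure \<Rightarrow> real ^ 'm" where
  "rv \<Phi> \<mu> = (\<chi> i. \<integral>x. apply_bcontfun \<Phi> x $ i \<partial>\<mu>)"

definition Rot :: "('a::topological_space \<Rightarrow> 'a) \<Rightarrow> ('a \<Rightarrow>\<^sub>C (real ^ 'm)) \<Rightarrow> (real ^ 'm) set" where
  "Rot f \<Phi> = rv \<Phi> ` invariant_measures f"

definition localized_entropy ::
  "('a::topological_space \<Rightarrow> 'a) \<Rightarrow> ('a \<Rightarrow>\<^sub>C (real ^ 'm)) \<Rightarrow> real ^ 'm \<Rightarrow> ereal" where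
  "localized_entropy f \<Phi> w =
     (SUP \<mu>\<in>{\<mu> \<in> invariant_measures f. rv \<Phi> \<mu> = w}. measure_entropy f \<mu>)"

text \<open>The default metric on a product type is the Euclidean combination of the two distances;
  here the sum is used instead.\<close>

definition sum_dist :: "'b::metric_space \<times> 'c::metric_space \<Rightarrow> 'b \<times> 'c \<Rightarrow> real" where
  "sum_dist p q = dist (fst p) (fst q) + dist (snd p) (snd q)"

lemma Metric_space_sum_dist:
  "Metric_space UNIV (sum_dist :: 'b::metric_space \<times> 'c::metric_space \<Rightarrow> _)"
proof
  fix p q r :: "'b \<times> 'c"
  show "0 \<le> sum_dist p q" by (simp add: sum_dist_def)
  show "sum_dist p q = sum_dist q p" by (simp add: sum_dist_def dist_commute)
  show "(sum_dist p q = 0) = (p = q)"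
    by (simp add: sum_dist_def add_nonneg_eq_0_iff prod_eq_iff)
  show "sum_dist p r \<le> sum_dist p q + sum_dist q r"
    using dist_triangle[of "fst p" "fst r" "fst q"] dist_triangle[of "snd p" "snd r" "snd q"]
    by (simp add: sum_dist_def)
qed

end

theory Submission
  imports Defs
begin

text \<open>If \<open>\<nu>\<close> is a convex combination of invariant measures in which \<open>\<mu>\<close> has weight \<open>t\<close>, then
  \<open>h\<^sub>\<nu> \<ge> t h\<^sub>\<mu>\<close>, by concavity of \<open>- x ln x\<close>. So if the ball of radius \<open>r\<close> about \<open>v\<close> lies in
  \<open>Rot \<Psi>\<close> and \<open>rv \<Psi> \<mu>\<close> has distance at most \<open>d\<close> from \<open>v\<close>, then moving \<open>\<mu>\<close> slightly towards a measure
  whose rotation vector lies beyond \<open>v\<close> gives \<open>h\<^sub>\<mu> \<le> (1 + d / r) H\<^sub>\<Psi>(v)\<close>. A measure with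
  \<open>rv \<Phi> \<mu> = w\<close> has \<open>d \<le> \<parallel>\<Phi> - \<Psi>\<parallel> + |w - v|\<close>, hence \<open>H\<^sub>\<Phi>(w) \<le> (1 + d / r) H\<^sub>\<Psi>(v)\<close>. By a
  separating hyperplane the radius \<open>r\<close> can be chosen uniformly near a given point, so the
  inequality holds in both directions and the factor tends to \<open>1\<close>.\<close>

section \<open>Subadditive sequences and the concavity of - x ln x\<close>

text \<open>The limit is the infimum of the quotients. If \<open>a m / real m\<close> nearly attains
  it, division of \<open>n\<close> by \<open>m\<close> with remainder bounds \<open>a n\<close> by
  \<open>n div m\<close> copies of \<open>a m\<close> plus one of finitely many remainder terms,
  whose share vanishes after division by \<open>n\<close>.\<close>

lemma fekete:
  fixes a :: "nat \<Rightarrow> real"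
  assumes sub: "\<And>m n. a (m + n) \<le> a m + a n" and nonneg: "\<And>n. 0 \<le> a n"
  shows "convergent (\<lambda>n. a n / real n)"
proof -
  define L where "L = (INF n\<in>{1..}. a n / real n)"
  have bdd: "bdd_below ((\<lambda>n. a n / real n) ` {1..})"
    by (rule bdd_belowI[of _ 0]) (auto simp: nonneg)
  have lower: "L \<le> a n / real n" if "n \<ge> 1" for n
    unfolding L_def by (rule cINF_lower[OF bdd]) (use that in auto)
  have mult: "a (q * m + r) \<le> real q * a m + a r" for q m r
  proof (induction q)
    case (Suc q)
    show ?case using sub[of m "q * m + r"] Suc by (simp add: algebra_simps)
  qed simp
  have "(\<lambda>n. a n / real n) \<longlonglongrightarrow> L"
  proof (rule tendstoI)
    fix e :: real assume "e > 0"
    then have "\<exists>m\<in>{1..}. a m / real m < L + e / 2"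
      using cINF_less_iff[OF _ bdd, of "L + e / 2"] unfolding L_def by auto
    then obtain m where m: "m \<ge> 1" "a m / real m < L + e / 2" by auto
    \<comment> \<open>\<open>B\<close> dominates \<open>a r\<close> for every possible remainder
      \<open>r < m\<close>, since all terms are nonnegative.\<close>
    define B where "B = (\<Sum>r<m. a r)"
    have "(\<lambda>n. B / real n) \<longlonglongrightarrow> 0" by (rule lim_const_over_n)
    then have "eventually (\<lambda>n. B / real n < e / 2) sequentially"
      using \<open>e > 0\<close> by (intro order_tendstoD(2)[of _ 0]) auto
    then show "eventually (\<lambda>n. dist (a n / real n) L < e) sequentially"
      using eventually_ge_at_top[of 1]
    proof eventually_elim
      case (elim n)
      have aB: "a (n mod m) \<le> B"
        unfolding B_def using m nonneg by (intro member_le_sum) auto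
      have q: "real (n div m) * a m \<le> (real n / real m) * a m"
        by (intro mult_right_mono nonneg) (rule of_nat_div_le_of_nat)
      have "a n \<le> (real n / real m) * a m + B"
        using mult[of "n div m" m "n mod m"] q aB by simp
      then have "a n / real n \<le> a m / real m + B / real n"
        using elim m by (simp add: field_simps)
      then have "a n / real n - L < e" using elim m by linarith
      then show ?case using lower[of n] elim by (simp add: dist_real_def)
    qed
  qed
  then show ?thesis by (rule convergentI)
qed

text \<open>This is ln x \<le> x - 1 at x = c / a, multiplied by \<open>a\<close>. It is the common
  source of the concavity of - x ln x and of the subadditivity of partition entropy.\<close>

lemma mult_ln_diff_le:
  fixes a c :: real
  assumes "0 \<le> a" "0 < c"
  shows "a * (ln c - ln a) \<le> c - a"
proof (cases "a = 0")
  case False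
  then have "ln (c / a) \<le> c / a - 1" using assms by (intro ln_le_minus_one) auto
  then show ?thesis using False assms by (simp add: ln_div field_simps)
qed (use assms in simp)

text \<open>The preceding inequality is applied to \<open>a\<close> and to \<open>b\<close>, both
  against the mean \<open>c\<close>. With weights \<open>t\<close> and \<open>1 - t\<close> the
  right-hand sides cancel.\<close>

lemma neg_mult_ln_concave:
  fixes a b t :: real
  assumes "0 \<le> a" "0 \<le> b" "0 < t" "t < 1"
  defines "c \<equiv> t * a + (1 - t) * b"
  shows "t * (- (a * ln a)) + (1 - t) * (- (b * ln b)) \<le> - (c * ln c)"
proof (cases "c = 0")
  case True
  then have "t * a = 0" "(1 - t) * b = 0"
    using assms add_nonneg_eq_0_iff[of "t * a" "(1 - t) * b"] by auto
  then show ?thesis using True assms by auto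
next
  case False
  then have c: "c > 0" using assms by (simp add: c_def less_le)
  have "t * (a * (ln c - ln a)) + (1 - t) * (b * (ln c - ln b)) \<le> t * (c - a) + (1 - t) * (c - b)"
    using assms c by (intro add_mono mult_left_mono mult_ln_diff_le) auto
  also have "\<dots> = 0" by (simp add: c_def algebra_simps)
  finally have "t * (- (a * ln a)) + (1 - t) * (- (b * ln b)) \<le> - ((t * a + (1 - t) * b) * ln c)"
    by (simp add: algebra_simps)
  then show ?thesis by (simp only: c_def)
qed

subsection \<open>Finite Borel partitions and their entropy\<close>

abbreviation borel_partitions :: "'a::topological_space set set set" where
  "borel_partitions \<equiv> finite_measurable_partitions borel"

lemma borel_partitions_iff:
  "\<xi> \<in> borel_partitions \<longleftrightarrow>
     finite \<xi> \<and> \<xi> \<subseteq> sets borel \<and> \<Union>\<xi> = UNIV \<and> disjoint \<xi> \<and> {} \<notin> \<xi>"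
  by (auto simp: finite_measurable_partitions_def partition_on_def)

lemma borel_partition_eqI:
  "\<xi> \<in> borel_partitions \<Longrightarrow> A \<in> \<xi> \<Longrightarrow> B \<in> \<xi> \<Longrightarrow> x \<in> A \<Longrightarrow> x \<in> B \<Longrightarrow> A = B"
  by (auto simp: borel_partitions_iff dest: disjointD)

lemma finite_measurable_partitions_cong:
  "sets \<mu> = sets \<nu> \<Longrightarrow> finite_measurable_partitions \<mu> = finite_measurable_partitions \<nu>"
  by (simp add: finite_measurable_partitions_def sets_eq_imp_space_eq[of \<mu> \<nu>])

lemma UNIV_borel_partition: "{UNIV} \<in> borel_partitions"
  by (simp add: borel_partitions_iff)

lemma partition_join_in:
  assumes "\<xi> \<in> borel_partitions" "\<eta> \<in> borel_partitions"
  shows "partition_join \<xi> \<eta> \<in> borel_partitions"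
proof -
  have eq: "partition_join \<xi> \<eta> = (\<lambda>(A, B). A \<inter> B) ` (\<xi> \<times> \<eta>) - {{}}"
    by (auto simp: partition_join_def)
  have "finite (partition_join \<xi> \<eta>)"
    unfolding eq using assms by (auto simp: borel_partitions_iff)
  moreover have "partition_join \<xi> \<eta> \<subseteq> sets borel"
    unfolding eq using assms by (auto simp: borel_partitions_iff)
  moreover have "\<exists>C\<in>partition_join \<xi> \<eta>. x \<in> C" for x
  proof -
    from assms have "x \<in> \<Union>\<xi>" "x \<in> \<Union>\<eta>" by (auto simp: borel_partitions_iff)
    then show ?thesis unfolding partition_join_def by blast
  qed
  moreover have "disjoint (partition_join \<xi> \<eta>)"
    using assms unfolding partition_join_def disjoint_def borel_partitions_iff by blast
  ultimately show ?thesis unfolding borel_partitions_iff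
    by (auto simp: partition_join_def)
qed

lemma partition_preimage_in:
  assumes "\<xi> \<in> borel_partitions" and g: "g \<in> borel \<rightarrow>\<^sub>M borel"
  shows "partition_preimage g \<xi> \<in> borel_partitions"
proof -
  have "partition_preimage g \<xi> \<subseteq> sets borel"
    using measurable_sets[OF g] assms(1)
    by (auto simp: partition_preimage_def borel_partitions_iff)
  moreover have "\<exists>C\<in>partition_preimage g \<xi>. x \<in> C" for x
  proof -
    from assms(1) have "g x \<in> \<Union>\<xi>" by (auto simp: borel_partitions_iff)
    then show ?thesis unfolding partition_preimage_def by blast
  qed
  moreover have "disjoint (partition_preimage g \<xi>)"
    using assms(1) unfolding partition_preimage_def borel_partitions_iff
    by (auto intro!: disjointI dest: disjointD)
  ultimately show ?thesis using assms(1) unfolding borel_partitions_iff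
    by (auto simp: partition_preimage_def)
qed

section \<open>Algebra of joins and preimages of partitions\<close>

text \<open>Both sides consist of the nonempty triple intersections: an empty set removed at the
  inner join could only produce empty cells at the outer one.\<close>

lemma partition_join_assoc:
  "partition_join (partition_join \<xi> \<eta>) \<zeta> = partition_join \<xi> (partition_join \<eta> \<zeta>)"
proof -
  have "C \<in> partition_join (partition_join \<xi> \<eta>) \<zeta> \<longleftrightarrow>
      C \<noteq> {} \<and> (\<exists>A\<in>\<xi>. \<exists>B\<in>\<eta>. \<exists>D\<in>\<zeta>. C = A \<inter> B \<inter> D)" for C
    unfolding partition_join_def by blast
  moreover have "C \<in> partition_join \<xi> (partition_join \<eta> \<zeta>) \<longleftrightarrow>
      C \<noteq> {} \<and> (\<exists>A\<in>\<xi>. \<exists>B\<in>\<eta>. \<exists>D\<in>\<zeta>. C = A \<inter> B \<inter> D)" for C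
    unfolding partition_join_def Int_assoc by blast
  ultimately show ?thesis by (intro set_eqI) simp
qed

lemma partition_preimage_join:
  "partition_preimage g (partition_join \<xi> \<eta>) =
     partition_join (partition_preimage g \<xi>) (partition_preimage g \<eta>)"
proof (intro equalityI subsetI)
  fix C assume "C \<in> partition_join (partition_preimage g \<xi>) (partition_preimage g \<eta>)"
  then obtain A B where C: "A \<in> \<xi>" "B \<in> \<eta>" "C = g -` (A \<inter> B)" "C \<noteq> {}"
    by (auto simp: partition_join_def partition_preimage_def)
  then have "A \<inter> B \<in> partition_join \<xi> \<eta>" by (auto simp: partition_join_def)
  with C(3,4) show "C \<in> partition_preimage g (partition_join \<xi> \<eta>)"
    unfolding partition_preimage_def by blast
next
  fix C assume "C \<in> partition_preimage g (partition_join \<xi> \<eta>)"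
  then obtain A B where C: "A \<in> \<xi>" "B \<in> \<eta>" "C = g -` A \<inter> g -` B" "C \<noteq> {}"
    by (auto simp: partition_join_def partition_preimage_def)
  then have "g -` A \<in> partition_preimage g \<xi>" "g -` B \<in> partition_preimage g \<eta>"
    by (auto simp: partition_preimage_def)
  with C show "C \<in> partition_join (partition_preimage g \<xi>) (partition_preimage g \<eta>)"
    by (auto simp: partition_join_def)
qed

lemma partition_preimage_comp:
  "partition_preimage g (partition_preimage h \<xi>) = partition_preimage (h \<circ> g) \<xi>"
  unfolding partition_preimage_def by (auto simp: vimage_comp[symmetric])

text \<open>The factors with index from \<open>m\<close> to \<open>m + n - 1\<close> are the
  pullback by \<open>f ^^ m\<close> of the factors with index below \<open>n\<close>. This splitting
  makes the entropies of the iterated partitions subadditive.\<close>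

lemma iterated_partition_add:
  assumes "{} \<notin> \<xi>"
  shows "iterated_partition f \<xi> (m + n) =
    partition_join (iterated_partition f \<xi> m) (partition_preimage (f ^^ m) (iterated_partition f \<xi> n))"
proof (induction n)
  case 0
  \<comment> \<open>Joining with the trivial partition only removes the empty set, which must
    therefore be absent already.\<close>
  have "{} \<notin> iterated_partition f \<xi> m"
    by (cases m) (auto simp: partition_join_def)
  then show ?case by (auto simp: partition_join_def partition_preimage_def)
next
  case (Suc n)
  have "f ^^ (m + n) = f ^^ n \<circ> f ^^ m" by (simp add: funpow_add[symmetric] add.commute)
  with Suc show ?case
    by (simp add: partition_preimage_join partition_join_assoc partition_preimage_comp)
qed

section \<open>Entropy of a join of partitions\<close>

lemma partition_entropy_nonneg:
  assumes "prob_space \<mu>"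
  shows "0 \<le> partition_entropy \<mu> \<xi>"
proof -
  interpret prob_space \<mu> by fact
  have "measure \<mu> A * ln (measure \<mu> A) \<le> 0" for A
  proof (cases "measure \<mu> A = 0")
    case False
    then have "0 < measure \<mu> A" using measure_nonneg[of \<mu> A] by linarith
    then show ?thesis by (intro mult_nonneg_nonpos) auto
  qed simp
  then show ?thesis by (simp add: partition_entropy_def sum_nonpos)
qed

lemma measure_sum_partition:
  assumes "prob_space \<mu>" "sets \<mu> = sets borel" "\<eta> \<in> borel_partitions" "A \<in> sets borel"
  shows "(\<Sum>B\<in>\<eta>. measure \<mu> (A \<inter> B)) = measure \<mu> A"
proof -
  interpret prob_space \<mu> by fact
  have "measure \<mu> (\<Union>B\<in>\<eta>. A \<inter> B) = (\<Sum>B\<in>\<eta>. measure \<mu> (A \<inter> B))"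
  proof (rule measure_UNION')
    show "pairwise (\<lambda>B C. disjnt (A \<inter> B) (A \<inter> C)) \<eta>"
      using assms(3) by (auto simp: borel_partitions_iff elim!: pairwise_mono simp: disjnt_def)
  qed (use assms fmeasurable_eq_sets in \<open>auto simp: borel_partitions_iff\<close>)
  moreover have "(\<Union>B\<in>\<eta>. A \<inter> B) = A"
    using assms(3) by (auto simp: borel_partitions_iff)
  ultimately show ?thesis by simp
qed

text \<open>A nonempty cell of the join determines the pair it comes from, and pairs with empty
  intersection contribute 0 ln 0 = 0. The sum over cells thus becomes a full double sum.\<close>

lemma partition_entropy_join:
  assumes "\<xi> \<in> borel_partitions" "\<eta> \<in> borel_partitions"
  shows "partition_entropy \<mu> (partition_join \<xi> \<eta>) =
    - (\<Sum>A\<in>\<xi>. \<Sum>B\<in>\<eta>. measure \<mu> (A \<inter> B) * ln (measure \<mu> (A \<inter> B)))"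
proof -
  let ?P = "{p \<in> \<xi> \<times> \<eta>. fst p \<inter> snd p \<noteq> {}}" and ?h = "\<lambda>p :: 'a set \<times> 'a set. fst p \<inter> snd p"
  let ?\<phi> = "\<lambda>C. measure \<mu> C * ln (measure \<mu> C)"
  have fin: "finite \<xi>" "finite \<eta>" using assms by (auto simp: borel_partitions_iff)
  have img: "partition_join \<xi> \<eta> = ?h ` ?P"
    by (auto simp: partition_join_def image_def Bex_def)
  have "inj_on ?h ?P"
  proof (rule inj_onI)
    fix p q assume pq: "p \<in> ?P" "q \<in> ?P" "?h p = ?h q"
    then obtain x where "x \<in> ?h p" "x \<in> ?h q" by blast
    then have "x \<in> fst p" "x \<in> fst q" "x \<in> snd p" "x \<in> snd q" by auto
    moreover have "fst p \<in> \<xi>" "fst q \<in> \<xi>" "snd p \<in> \<eta>" "snd q \<in> \<eta>" using pq by auto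
    ultimately have "fst p = fst q" "snd p = snd q"
      using borel_partition_eqI[OF assms(1)] borel_partition_eqI[OF assms(2)] by metis+
    then show "p = q" by (rule prod_eqI)
  qed
  then have "sum ?\<phi> (partition_join \<xi> \<eta>) = (\<Sum>p\<in>?P. ?\<phi> (?h p))"
    unfolding img by (simp add: sum.reindex)
  also have "\<dots> = (\<Sum>p\<in>\<xi> \<times> \<eta>. ?\<phi> (?h p))"
    using fin by (intro sum.mono_neutral_left) auto
  also have "\<dots> = (\<Sum>A\<in>\<xi>. \<Sum>B\<in>\<eta>. ?\<phi> (A \<inter> B))"
    by (simp add: sum.cartesian_product case_prod_unfold)
  finally show ?thesis by (simp add: partition_entropy_def)
qed

text \<open>This is the nonnegativity of mutual information: \<open>mult_ln_diff_le\<close> compares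
  the joint weights with the product weights on each pair of cells, and both families of weights
  have total 1.\<close>

lemma partition_entropy_join_le:
  assumes \<mu>: "prob_space \<mu>" "sets \<mu> = sets borel"
    and \<xi>: "\<xi> \<in> borel_partitions" and \<eta>: "\<eta> \<in> borel_partitions"
  shows "partition_entropy \<mu> (partition_join \<xi> \<eta>) \<le> partition_entropy \<mu> \<xi> + partition_entropy \<mu> \<eta>"
proof -
  interpret prob_space \<mu> by fact
  let ?m = "measure \<mu>"
  have sets: "A \<in> sets \<mu>" if "A \<in> \<xi> \<or> A \<in> \<eta>" for A
    using that \<xi> \<eta> \<mu>(2) by (auto simp: borel_partitions_iff)
  \<comment> \<open>If the intersection is null, the left side is 0. Otherwise both cells have
    positive measure, so the logarithm of their product splits.\<close>
  have le: "?m (A \<inter> B) * (ln (?m A) + ln (?m B) - ln (?m (A \<inter> B))) \<le> ?m A * ?m B - ?m (A \<inter> B)"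
    if "A \<in> \<xi>" "B \<in> \<eta>" for A B
  proof (cases "?m (A \<inter> B) = 0")
    case False
    then have "0 < ?m (A \<inter> B)" using measure_nonneg[of \<mu> "A \<inter> B"] by linarith
    moreover have "?m (A \<inter> B) \<le> ?m A" "?m (A \<inter> B) \<le> ?m B"
      using sets that by (auto intro!: finite_measure_mono)
    ultimately have "0 < ?m A" "0 < ?m B" by linarith+
    then show ?thesis
      using mult_ln_diff_le[of "?m (A \<inter> B)" "?m A * ?m B"] by (simp add: ln_mult)
  qed simp
  have row: "(\<Sum>B\<in>\<eta>. ?m (A \<inter> B)) = ?m A" if "A \<in> \<xi>" for A
    using measure_sum_partition[OF \<mu> \<eta>] \<xi> that by (auto simp: borel_partitions_iff)
  have col: "(\<Sum>A\<in>\<xi>. ?m (A \<inter> B)) = ?m B" if "B \<in> \<eta>" for B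
    using measure_sum_partition[OF \<mu> \<xi>, of B] \<eta> that by (auto simp: borel_partitions_iff Int_commute)
  have tot: "(\<Sum>A\<in>\<zeta>. ?m A) = 1" if "\<zeta> \<in> borel_partitions" for \<zeta>
    using measure_sum_partition[OF \<mu> that, of UNIV] prob_space sets_eq_imp_space_eq[OF \<mu>(2)] by simp
  \<comment> \<open>The factors in front of \<open>ln (?m A)\<close> and \<open>ln (?m B)\<close>
    are written as marginal sums, so that all three terms become sums over pairs of cells.\<close>
  have "partition_entropy \<mu> (partition_join \<xi> \<eta>) - (partition_entropy \<mu> \<xi> + partition_entropy \<mu> \<eta>)
      = (\<Sum>A\<in>\<xi>. (\<Sum>B\<in>\<eta>. ?m (A \<inter> B)) * ln (?m A)) + (\<Sum>B\<in>\<eta>. (\<Sum>A\<in>\<xi>. ?m (A \<inter> B)) * ln (?m B))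
        - (\<Sum>A\<in>\<xi>. \<Sum>B\<in>\<eta>. ?m (A \<inter> B) * ln (?m (A \<inter> B)))"
    unfolding partition_entropy_join[OF \<xi> \<eta>] by (simp add: partition_entropy_def row col)
  also have "\<dots> = (\<Sum>A\<in>\<xi>. \<Sum>B\<in>\<eta>. ?m (A \<inter> B) * (ln (?m A) + ln (?m B) - ln (?m (A \<inter> B))))"
    unfolding sum_distrib_right sum.swap[of "\<lambda>A B. ?m (A \<inter> B) * ln (?m B)" \<eta> \<xi>, symmetric]
    by (simp only: sum.distrib sum_subtractf distrib_left right_diff_distrib)
  also have "\<dots> \<le> (\<Sum>A\<in>\<xi>. \<Sum>B\<in>\<eta>. ?m A * ?m B - ?m (A \<inter> B))"
    by (intro sum_mono le)
  also have "\<dots> = 0"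
    by (simp add: sum_subtractf row sum_distrib_left[symmetric] tot \<xi> \<eta>)
  finally show ?thesis by simp
qed

section \<open>Invariance and the existence of the entropy limit\<close>

lemma invariant_measuresD:
  assumes "\<mu> \<in> invariant_measures f"
  shows "prob_space \<mu>" "sets \<mu> = sets borel" "space \<mu> = UNIV" "distr \<mu> borel f = \<mu>"
  using assms sets_eq_imp_space_eq[of \<mu> borel] by (auto simp: invariant_measures_def)

lemma measure_vimage_funpow:
  assumes \<mu>: "\<mu> \<in> invariant_measures f" and f: "f \<in> borel \<rightarrow>\<^sub>M borel" and A: "A \<in> sets borel"
  shows "measure \<mu> ((f ^^ n) -` A) = measure \<mu> A"
proof (induction n)
  case (Suc n)
  note \<mu>' = invariant_measuresD[OF \<mu>]
  have f': "f \<in> \<mu> \<rightarrow>\<^sub>M borel"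
    using f by (simp add: measurable_cong_sets[OF \<mu>'(2) refl])
  have "(f ^^ n) -` A \<in> sets borel"
    using measurable_sets[OF measurable_compose_n[OF f] A] by simp
  then have "measure (distr \<mu> borel f) ((f ^^ n) -` A) = measure \<mu> (f -` ((f ^^ n) -` A))"
    using measure_distr[OF f'] \<mu>'(3) by simp
  then show ?case
    using Suc \<mu>'(4) by (simp only: funpow_Suc_right vimage_comp)
qed simp

text \<open>Pulling back preserves the measure of each cell and keeps distinct nonempty pullbacks
  distinct. The cells lost because their pullback is empty have measure 0.\<close>

lemma partition_entropy_preimage:
  assumes \<mu>: "\<mu> \<in> invariant_measures f" and f: "f \<in> borel \<rightarrow>\<^sub>M borel"
    and \<xi>: "\<xi> \<in> borel_partitions"
  shows "partition_entropy \<mu> (partition_preimage (f ^^ n) \<xi>) = partition_entropy \<mu> \<xi>"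
proof -
  let ?g = "\<lambda>A. (f ^^ n) -` A" and ?\<phi> = "\<lambda>C. measure \<mu> C * ln (measure \<mu> C)"
  let ?P = "{A \<in> \<xi>. ?g A \<noteq> {}}"
  have pre: "measure \<mu> (?g A) = measure \<mu> A" if "A \<in> \<xi>" for A
    using measure_vimage_funpow[OF \<mu> f] \<xi> that by (auto simp: borel_partitions_iff)
  have "inj_on ?g ?P"
  proof (rule inj_onI)
    fix A B assume AB: "A \<in> ?P" "B \<in> ?P" "?g A = ?g B"
    then obtain x where "(f ^^ n) x \<in> A" "(f ^^ n) x \<in> B" by blast
    moreover have "A \<in> \<xi>" "B \<in> \<xi>" using AB by auto
    ultimately show "A = B" by (metis borel_partition_eqI[OF \<xi>])
  qed
  moreover have "partition_preimage (f ^^ n) \<xi> = ?g ` ?P"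
    by (auto simp: partition_preimage_def)
  ultimately have "sum ?\<phi> (partition_preimage (f ^^ n) \<xi>) = (\<Sum>A\<in>?P. ?\<phi> (?g A))"
    by (simp add: sum.reindex)
  also have "\<dots> = (\<Sum>A\<in>\<xi>. ?\<phi> (?g A))"
    using \<xi> by (intro sum.mono_neutral_left) (auto simp: borel_partitions_iff)
  also have "\<dots> = (\<Sum>A\<in>\<xi>. ?\<phi> A)"
    by (intro sum.cong) (simp_all add: pre)
  finally show ?thesis by (simp add: partition_entropy_def)
qed

lemma iterated_partition_in:
  assumes f: "f \<in> borel \<rightarrow>\<^sub>M borel" and \<xi>: "\<xi> \<in> borel_partitions"
  shows "iterated_partition f \<xi> n \<in> borel_partitions"
  by (induction n)
    (auto intro: UNIV_borel_partition partition_join_in partition_preimage_in \<xi>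
      measurable_compose_n[OF f])

text \<open>The value of \<open>lim\<close> is meaningful only for convergent sequences. Convergence
  follows from \<open>fekete\<close>: the iterated partition splits as a join, join entropy is
  subadditive, and invariance removes the pullback from the second summand.\<close>

lemma entropy_wrt_partition_LIMSEQ:
  assumes \<mu>: "\<mu> \<in> invariant_measures f" and f: "f \<in> borel \<rightarrow>\<^sub>M borel"
    and \<xi>: "\<xi> \<in> borel_partitions"
  shows "(\<lambda>n. partition_entropy \<mu> (iterated_partition f \<xi> n) / real n)
           \<longlonglongrightarrow> entropy_wrt_partition f \<mu> \<xi>"
proof -
  note \<mu>' = invariant_measuresD[OF \<mu>]
  have "convergent (\<lambda>n. partition_entropy \<mu> (iterated_partition f \<xi> n) / real n)"
  proof (rule fekete)
    fix m n
    have "{} \<notin> \<xi>" using \<xi> by (simp add: borel_partitions_iff)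
    then show "partition_entropy \<mu> (iterated_partition f \<xi> (m + n)) \<le>
        partition_entropy \<mu> (iterated_partition f \<xi> m) + partition_entropy \<mu> (iterated_partition f \<xi> n)"
      using partition_entropy_join_le[OF \<mu>'(1,2) iterated_partition_in[OF f \<xi>, of m]
          partition_preimage_in[OF iterated_partition_in[OF f \<xi>, of n] measurable_compose_n[OF f, of m]]]
      by (simp add: iterated_partition_add
          partition_entropy_preimage[OF \<mu> f iterated_partition_in[OF f \<xi>]])
  qed (rule partition_entropy_nonneg[OF \<mu>'(1)])
  then show ?thesis by (simp add: entropy_wrt_partition_def convergent_LIMSEQ_iff)
qed

lemma entropy_wrt_partition_nonneg:
  assumes \<mu>: "\<mu> \<in> invariant_measures f" and f: "f \<in> borel \<rightarrow>\<^sub>M borel"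
    and \<xi>: "\<xi> \<in> borel_partitions"
  shows "0 \<le> entropy_wrt_partition f \<mu> \<xi>"
  by (rule LIMSEQ_le_const[OF entropy_wrt_partition_LIMSEQ[OF assms]])
    (auto intro!: divide_nonneg_nonneg partition_entropy_nonneg invariant_measuresD(1)[OF \<mu>])

text \<open>The trivial partition takes part in the supremum and has nonnegative entropy.\<close>

lemma measure_entropy_nonneg:
  assumes \<mu>: "\<mu> \<in> invariant_measures f" and f: "f \<in> borel \<rightarrow>\<^sub>M borel"
  shows "0 \<le> measure_entropy f \<mu>"
proof -
  have "{UNIV} \<in> finite_measurable_partitions \<mu>"
    using UNIV_borel_partition finite_measurable_partitions_cong[OF invariant_measuresD(2)[OF \<mu>]]
    by simp
  then show ?thesis unfolding measure_entropy_def
    using entropy_wrt_partition_nonneg[OF \<mu> f UNIV_borel_partition]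
    by (intro SUP_upper2) auto
qed

subsection \<open>Convex combinations of invariant measures\<close>

text \<open>The convex combination with weight \<open>t\<close> on \<open>\<mu>\<close> is encoded
  as a random choice: a Bernoulli variable selects the measure. Its total mass, integrals and
  measures of sets then come from the general facts about \<open>bind\<close>.\<close>

definition mix_measure :: "real \<Rightarrow> 'a measure \<Rightarrow> 'a measure \<Rightarrow> 'a measure" where
  "mix_measure t \<mu> \<nu> = measure_pmf (bernoulli_pmf t) \<bind> (\<lambda>b. if b then \<mu> else \<nu>)"

context
  fixes t :: real and \<mu> \<nu> :: "'a::topological_space measure"
  assumes t: "0 < t" "t < 1"
    and prob: "prob_space \<mu>" "prob_space \<nu>"
    and sets: "sets \<mu> = sets borel" "sets \<nu> = sets borel"
begin

lemma mix_kernel: "(\<lambda>b. if b then \<mu> else \<nu>) \<in> measure_pmf (bernoulli_pmf t) \<rightarrow>\<^sub>M subprob_algebra borel"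
  using prob sets by (auto simp: space_subprob_algebra prob_space_imp_subprob_space)

lemma prob_space_mix_measure: "prob_space (mix_measure t \<mu> \<nu>)"
  unfolding mix_measure_def
  by (rule measure_pmf.prob_space_bind[OF _ mix_kernel]) (use prob in auto)

lemma sets_mix_measure: "sets (mix_measure t \<mu> \<nu>) = sets borel"
  unfolding mix_measure_def
  by (rule sets_bind[OF sets_kernel[OF mix_kernel]]) auto

lemma integral_mix_measure_real:
  fixes g :: "'a \<Rightarrow> real"
  assumes "g \<in> borel_measurable borel" "\<And>x. \<bar>g x\<bar> \<le> B"
  shows "(\<integral>x. g x \<partial>mix_measure t \<mu> \<nu>) = t * (\<integral>x. g x \<partial>\<mu>) + (1 - t) * (\<integral>x. g x \<partial>\<nu>)"
proof -
  have "(\<integral>x. g x \<partial>mix_measure t \<mu> \<nu>) =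
      (\<integral>b. (\<integral>x. g x \<partial>(if b then \<mu> else \<nu>)) \<partial>measure_pmf (bernoulli_pmf t))"
    unfolding mix_measure_def
    \<comment> \<open>The bound \<open>B' = 1\<close> is for the total mass of the two measures
      being mixed.\<close>
    by (rule integral_bind[OF assms mix_kernel, where B' = 1])
      (use prob in \<open>auto simp: measure_pmf.finite_measure prob_space.emeasure_space_1\<close>)
  then show ?thesis using t by simp
qed

lemma measure_mix_measure:
  assumes "A \<in> sets borel"
  shows "measure (mix_measure t \<mu> \<nu>) A = t * measure \<mu> A + (1 - t) * measure \<nu> A"
  unfolding mix_measure_def
  using t by (subst measure_pmf.measure_bind[OF mix_kernel assms]) simp

text \<open>Concavity of - x ln x on each cell bounds the entropy of the mixture below by the
  mixture of the entropies; the nonnegative contribution of \<open>\<nu>\<close> is then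
  dropped.\<close>

lemma partition_entropy_mix_measure_ge:
  assumes "\<xi> \<in> borel_partitions"
  shows "t * partition_entropy \<mu> \<xi> \<le> partition_entropy (mix_measure t \<mu> \<nu>) \<xi>"
proof -
  have "t * partition_entropy \<mu> \<xi> \<le> t * partition_entropy \<mu> \<xi> + (1 - t) * partition_entropy \<nu> \<xi>"
    using t partition_entropy_nonneg[OF prob(2)] by simp
  also have "\<dots> = (\<Sum>A\<in>\<xi>. t * (- (measure \<mu> A * ln (measure \<mu> A)))
      + (1 - t) * (- (measure \<nu> A * ln (measure \<nu> A))))"
    by (simp only: partition_entropy_def sum.distrib sum_distrib_left sum_negf[symmetric])
  also have "\<dots> \<le> (\<Sum>A\<in>\<xi>. - (measure (mix_measure t \<mu> \<nu>) A * ln (measure (mix_measure t \<mu> \<nu>) A)))"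
  proof (rule sum_mono)
    fix A assume "A \<in> \<xi>"
    then have "A \<in> sets borel" using assms by (auto simp: borel_partitions_iff)
    then show "t * (- (measure \<mu> A * ln (measure \<mu> A))) + (1 - t) * (- (measure \<nu> A * ln (measure \<nu> A)))
        \<le> - (measure (mix_measure t \<mu> \<nu>) A * ln (measure (mix_measure t \<mu> \<nu>) A))"
      unfolding measure_mix_measure[OF \<open>A \<in> sets borel\<close>]
      using t by (intro neg_mult_ln_concave) auto
  qed
  finally show ?thesis by (simp add: partition_entropy_def sum_negf)
qed

end

lemma mix_measure_invariant:
  assumes t: "0 < t" "t < 1" and f: "f \<in> borel \<rightarrow>\<^sub>M borel"
    and \<mu>: "\<mu> \<in> invariant_measures f" and \<nu>: "\<nu> \<in> invariant_measures f"
  shows "mix_measure t \<mu> \<nu> \<in> invariant_measures f"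
proof -
  note \<mu>' = invariant_measuresD[OF \<mu>] and \<nu>' = invariant_measuresD[OF \<nu>]
  note mix = t \<mu>'(1) \<nu>'(1) \<mu>'(2) \<nu>'(2)
  let ?m = "mix_measure t \<mu> \<nu>"
  interpret m: prob_space ?m by (rule prob_space_mix_measure[OF mix])
  have sets: "sets ?m = sets borel" by (rule sets_mix_measure[OF mix])
  then have f': "f \<in> ?m \<rightarrow>\<^sub>M borel"
    using f by (simp add: measurable_cong_sets[OF sets refl])
  interpret d: prob_space "distr ?m borel f" by (rule m.prob_space_distr[OF f'])
  have "distr ?m borel f = ?m"
  proof (rule measure_eqI)
    fix A assume "A \<in> sets (distr ?m borel f)"
    then have A: "A \<in> sets borel" by simp
    then have fA: "f -` A \<in> sets borel" using measurable_sets[OF f A] by simp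
    have "measure (distr ?m borel f) A = measure ?m (f -` A)"
      using measure_distr[OF f' A] sets_eq_imp_space_eq[OF sets] by simp
    also have "\<dots> = measure ?m A"
      using measure_vimage_funpow[OF \<mu> f A, of 1] measure_vimage_funpow[OF \<nu> f A, of 1]
      by (simp add: measure_mix_measure[OF mix] A fA)
    finally show "emeasure (distr ?m borel f) A = emeasure ?m A"
      by (simp add: m.emeasure_eq_measure d.emeasure_eq_measure)
  qed (simp add: sets)
  then show ?thesis by (simp add: invariant_measures_def m.prob_space_axioms sets)
qed

text \<open>The estimate for a single partition holds for every iterated partition, so it passes to
  the limit. Dividing by \<open>t\<close> leaves the entropy of \<open>\<mu>\<close> alone on the
  left, where its supremum over partitions can be bounded term by term.\<close>

lemma measure_entropy_le_mix_measure:
  assumes t: "0 < t" "t < 1" and f: "f \<in> borel \<rightarrow>\<^sub>M borel"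
    and \<mu>: "\<mu> \<in> invariant_measures f" and \<nu>: "\<nu> \<in> invariant_measures f"
  shows "measure_entropy f \<mu> \<le> ereal (1 / t) * measure_entropy f (mix_measure t \<mu> \<nu>)"
proof -
  note \<mu>' = invariant_measuresD[OF \<mu>] and \<nu>' = invariant_measuresD[OF \<nu>]
  note mix = t \<mu>'(1) \<nu>'(1) \<mu>'(2) \<nu>'(2)
  let ?m = "mix_measure t \<mu> \<nu>"
  note m = mix_measure_invariant[OF assms]
  show ?thesis unfolding measure_entropy_def[of f \<mu>]
  proof (rule SUP_least)
    fix \<xi> assume "\<xi> \<in> finite_measurable_partitions \<mu>"
    then have \<xi>: "\<xi> \<in> borel_partitions"
      using finite_measurable_partitions_cong[OF \<mu>'(2)] by simp
    have "t * entropy_wrt_partition f \<mu> \<xi> \<le> entropy_wrt_partition f ?m \<xi>"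
    proof (rule LIMSEQ_le[OF tendsto_mult_left[OF entropy_wrt_partition_LIMSEQ[OF \<mu> f \<xi>]]
          entropy_wrt_partition_LIMSEQ[OF m f \<xi>]])
      show "\<exists>N. \<forall>n\<ge>N. t * (partition_entropy \<mu> (iterated_partition f \<xi> n) / real n)
          \<le> partition_entropy ?m (iterated_partition f \<xi> n) / real n"
        using partition_entropy_mix_measure_ge[OF mix iterated_partition_in[OF f \<xi>]]
        by (auto intro!: divide_right_mono)
    qed
    then have "ereal (entropy_wrt_partition f \<mu> \<xi>) \<le> ereal (1 / t) * ereal (entropy_wrt_partition f ?m \<xi>)"
      using t by (simp add: field_simps)
    also have "\<dots> \<le> ereal (1 / t) * measure_entropy f ?m"
      unfolding measure_entropy_def using \<xi> finite_measurable_partitions_cong[OF sets_mix_measure[OF mix]] t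
      by (intro ereal_mult_left_mono SUP_upper) auto
    finally show "ereal (entropy_wrt_partition f \<mu> \<xi>) \<le> ereal (1 / t) * measure_entropy f ?m" .
  qed
qed

subsection \<open>Rotation vectors and rotation sets\<close>

lemma bcontfun_component_measurable:
  "(\<lambda>x. apply_bcontfun (\<Phi> :: 'a::topological_space \<Rightarrow>\<^sub>C (real ^ 'm)) x $ i) \<in> borel_measurable borel"
  by (intro borel_measurable_continuous_onI continuous_intros) simp

lemma bcontfun_component_le: "\<bar>apply_bcontfun (\<Phi> :: 'a::topological_space \<Rightarrow>\<^sub>C (real ^ 'm)) x $ i\<bar> \<le> norm \<Phi>"
  using component_le_norm_cart norm_bounded by (rule order_trans)

lemma bcontfun_integrable:
  fixes \<Phi> :: "'a::topological_space \<Rightarrow>\<^sub>C (real ^ 'm)"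
  assumes "prob_space \<mu>" "sets \<mu> = sets borel"
  shows "integrable \<mu> (apply_bcontfun \<Phi>)"
proof -
  interpret prob_space \<mu> by fact
  have "apply_bcontfun \<Phi> \<in> borel_measurable borel"
    by (intro borel_measurable_continuous_onI) simp
  then have "apply_bcontfun \<Phi> \<in> borel_measurable \<mu>"
    by (simp add: measurable_cong_sets[OF assms(2) refl])
  then show ?thesis
    by (intro integrable_const_bound[of _ "norm \<Phi>"]) (auto intro: norm_bounded)
qed

text \<open>As a vector-valued integral, the rotation vector obeys the norm bound for integrals,
  which gives a distance estimate free of a dimensional constant.\<close>

lemma rv_eq_integral:
  fixes \<Phi> :: "'a::topological_space \<Rightarrow>\<^sub>C (real ^ 'm)"
  assumes "prob_space \<mu>" "sets \<mu> = sets borel"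
  shows "rv \<Phi> \<mu> = (\<integral>x. apply_bcontfun \<Phi> x \<partial>\<mu>)"
  unfolding rv_def vec_eq_iff
  using integral_bounded_linear[OF bounded_linear_vec_nth bcontfun_integrable[OF assms, of \<Phi>]] by simp

lemma dist_rv_le:
  fixes \<Phi> \<Psi> :: "'a::topological_space \<Rightarrow>\<^sub>C (real ^ 'm)"
  assumes "prob_space \<mu>" "sets \<mu> = sets borel"
  shows "dist (rv \<Phi> \<mu>) (rv \<Psi> \<mu>) \<le> dist \<Phi> \<Psi>"
proof -
  interpret prob_space \<mu> by fact
  note int = bcontfun_integrable[OF assms]
  have "norm (rv \<Phi> \<mu> - rv \<Psi> \<mu>) = norm (\<integral>x. apply_bcontfun \<Phi> x - apply_bcontfun \<Psi> x \<partial>\<mu>)"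
    by (simp add: rv_eq_integral[OF assms] int)
  also have "\<dots> \<le> (\<integral>x. norm (apply_bcontfun \<Phi> x - apply_bcontfun \<Psi> x) \<partial>\<mu>)"
    by (rule integral_norm_bound)
  also have "\<dots> \<le> (\<integral>x. dist \<Phi> \<Psi> \<partial>\<mu>)"
    by (intro integral_mono integrable_norm Bochner_Integration.integrable_diff int)
      (simp_all add: dist_norm[symmetric] dist_bounded)
  finally show ?thesis by (simp add: dist_norm prob_space)
qed

lemma rv_mix_measure:
  fixes \<Phi> :: "'a::topological_space \<Rightarrow>\<^sub>C (real ^ 'm)"
  assumes "0 < t" "t < 1" "\<mu> \<in> invariant_measures f" "\<nu> \<in> invariant_measures f"
  shows "rv \<Phi> (mix_measure t \<mu> \<nu>) = t *\<^sub>R rv \<Phi> \<mu> + (1 - t) *\<^sub>R rv \<Phi> \<nu>"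
  unfolding vec_eq_iff
  using integral_mix_measure_real[OF assms(1,2) invariant_measuresD(1)[OF assms(3)]
      invariant_measuresD(1)[OF assms(4)] invariant_measuresD(2)[OF assms(3)]
      invariant_measuresD(2)[OF assms(4)] bcontfun_component_measurable[of \<Phi>] bcontfun_component_le[of \<Phi>]]
  by (simp add: rv_def)

lemma convex_Rot:
  assumes f: "f \<in> borel \<rightarrow>\<^sub>M borel"
  shows "convex (Rot f \<Phi>)"
  unfolding convex_alt
proof (intro ballI allI impI)
  fix x y and u :: real assume xy: "x \<in> Rot f \<Phi>" "y \<in> Rot f \<Phi>" and u: "0 \<le> u \<and> u \<le> 1"
  from xy obtain \<mu> \<nu> where \<mu>: "\<mu> \<in> invariant_measures f" "\<nu> \<in> invariant_measures f"
    and eq: "x = rv \<Phi> \<mu>" "y = rv \<Phi> \<nu>" by (auto simp: Rot_def)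
  \<comment> \<open>The facts on mixtures require a weight strictly between 0 and 1, so the
    endpoints are separate.\<close>
  consider "u = 0" | "u = 1" | "0 < u" "u < 1" using u by linarith
  then show "(1 - u) *\<^sub>R x + u *\<^sub>R y \<in> Rot f \<Phi>"
  proof cases
    case 3
    then show ?thesis
      using mix_measure_invariant[OF _ _ f \<mu>(2,1)] rv_mix_measure[OF _ _ \<mu>(2,1), of u \<Phi>]
      unfolding Rot_def eq by (intro image_eqI[of _ _ "mix_measure u \<nu> \<mu>"]) auto
  qed (use xy in auto)
qed

text \<open>Every point of \<open>Rot f \<Phi>\<close> is within less than \<open>r\<close> of the
  convex set \<open>Rot f \<Psi>\<close>. If \<open>x\<close> were missing from the latter, a
  hyperplane would separate them, and moving away from \<open>Rot f \<Psi>\<close> by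
  \<open>r\<close> would reach a point of \<open>Rot f \<Phi>\<close> with no such neighbour. The
  radius \<open>3 * r\<close> pays for this move, for the distance from \<open>x\<close> to
  \<open>v\<close> and for that from \<open>v\<close> to \<open>w\<close>.\<close>

lemma cball_subset_Rot_perturb:
  fixes \<Phi> \<Psi> :: "'a::topological_space \<Rightarrow>\<^sub>C (real ^ 'm)"
  assumes f: "f \<in> borel \<rightarrow>\<^sub>M borel" and r: "0 < r"
    and ball: "cball w (3 * r) \<subseteq> Rot f \<Phi>" and "dist \<Phi> \<Psi> < r" "dist w v < r"
  shows "cball v r \<subseteq> Rot f \<Psi>"
proof (rule subsetI, rule ccontr)
  fix x assume x: "x \<in> cball v r" "x \<notin> Rot f \<Psi>"
  have approx: "\<exists>z\<in>Rot f \<Psi>. dist y z < r" if "y \<in> Rot f \<Phi>" for y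
  proof -
    obtain \<mu> where \<mu>: "\<mu> \<in> invariant_measures f" "y = rv \<Phi> \<mu>"
      using \<open>y \<in> Rot f \<Phi>\<close> by (auto simp: Rot_def)
    have "dist y (rv \<Psi> \<mu>) < r"
      using dist_rv_le[OF invariant_measuresD(1,2)[OF \<mu>(1)], of \<Phi> \<Psi>] \<mu>(2) assms(4) by simp
    then show ?thesis using \<mu>(1) by (auto simp: Rot_def)
  qed
  have "w \<in> Rot f \<Phi>" using ball r by auto
  then have "Rot f \<Psi> \<noteq> {}" using approx by blast
  then obtain a b where ab: "a \<noteq> 0" "\<forall>z\<in>{x}. a \<bullet> z \<le> b" "\<forall>z\<in>Rot f \<Psi>. a \<bullet> z \<ge> b"
    using separating_hyperplane_sets[of "{x}" "Rot f \<Psi>"] convex_Rot[OF f, of \<Psi>] x(2) by auto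
  \<comment> \<open>The vector \<open>a\<close> points towards \<open>Rot f \<Psi>\<close>, so
    \<open>y\<close> lies at depth \<open>r\<close> on the other side of the hyperplane through
    \<open>x\<close>; any point closer than \<open>r\<close> to \<open>y\<close> stays strictly on
    that side.\<close>
  define y where "y = x - r *\<^sub>R sgn a"
  have "dist x y = r" using ab(1) r by (simp add: y_def dist_norm norm_sgn)
  moreover have "dist v x \<le> r" using x(1) by simp
  ultimately have "dist w y \<le> 3 * r"
    using dist_triangle[of w x v] dist_triangle[of w y x] assms(5) by linarith
  then have "y \<in> Rot f \<Phi>" using ball by (auto simp only: mem_cball)
  then obtain z where z: "z \<in> Rot f \<Psi>" "dist y z < r" using approx by blast
  have "a \<bullet> sgn a = norm a"
    using ab(1) by (simp add: sgn_div_norm dot_square_norm power2_eq_square)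
  then have "a \<bullet> z = a \<bullet> x - r * norm a + a \<bullet> (z - y)"
    by (simp add: y_def inner_diff_right)
  also have "a \<bullet> (z - y) \<le> norm a * norm (z - y)" by (rule norm_cauchy_schwarz)
  also have "norm a * norm (z - y) < norm a * r"
    using z(2) ab(1) by (simp add: dist_norm norm_minus_commute)
  finally have "a \<bullet> z < a \<bullet> x" by (simp add: mult.commute)
  then show False using ab z(1) by fastforce
qed

subsection \<open>Comparison of localized entropies\<close>

lemma localized_entropy_nonneg:
  assumes f: "f \<in> borel \<rightarrow>\<^sub>M borel" and "w \<in> Rot f \<Phi>"
  shows "0 \<le> localized_entropy f \<Phi> w"
proof -
  obtain \<mu> where "\<mu> \<in> invariant_measures f" "rv \<Phi> \<mu> = w"
    using assms(2) by (auto simp: Rot_def)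
  then show ?thesis unfolding localized_entropy_def
    using measure_entropy_nonneg[OF _ f] by (intro SUP_upper2[of \<mu>]) auto
qed

text \<open>A mixture of \<open>\<mu>\<close> with a suitable \<open>\<nu>\<close> has rotation
  vector exactly \<open>v\<close> and so competes in the supremum for \<open>v\<close>. The factor
  is the reciprocal of the weight of \<open>\<mu>\<close>. Taking \<open>d\<close> as an upper bound
  for the distance allows \<open>sum_dist\<close> to be inserted later.\<close>

lemma measure_entropy_le_localized_entropy:
  fixes \<Phi> :: "'a::topological_space \<Rightarrow>\<^sub>C (real ^ 'm)"
  assumes f: "f \<in> borel \<rightarrow>\<^sub>M borel" and r: "0 < r" and ball: "cball v r \<subseteq> Rot f \<Phi>"
    and \<mu>: "\<mu> \<in> invariant_measures f" and d: "dist (rv \<Phi> \<mu>) v \<le> d"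
  shows "measure_entropy f \<mu> \<le> ereal (1 + d / r) * localized_entropy f \<Phi> v"
\<comment> \<open>For \<open>d = 0\<close> the measure \<open>\<mu>\<close> itself has rotation
  vector \<open>v\<close>; the construction in the other case divides by \<open>d\<close>.\<close>
proof (cases "d = 0")
  case True
  then have "measure_entropy f \<mu> \<le> localized_entropy f \<Phi> v"
    unfolding localized_entropy_def using \<mu> d by (intro SUP_upper) auto
  then show ?thesis using True by simp
next
  case False
  with d have "0 < d" using zero_le_dist[of "rv \<Phi> \<mu>" v] by linarith
  define t where "t = r / (r + d)"
  have t: "0 < t" "t < 1" using r \<open>0 < d\<close> by (auto simp: t_def)
  \<comment> \<open>\<open>v\<close> divides the segment from \<open>rv \<Phi> \<mu>\<close> to \<open>u\<close> in the ratio \<open>d : r\<close>.\<close>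
  define u where "u = v + (r / d) *\<^sub>R (v - rv \<Phi> \<mu>)"
  have "dist v u = (r / d) * dist (rv \<Phi> \<mu>) v"
    using r \<open>0 < d\<close> by (simp add: u_def dist_norm norm_minus_commute)
  also have "\<dots> \<le> (r / d) * d"
    using r \<open>0 < d\<close> d by (intro mult_left_mono) auto
  finally have "u \<in> Rot f \<Phi>" using ball \<open>0 < d\<close> by auto
  then obtain \<nu> where \<nu>: "\<nu> \<in> invariant_measures f" "rv \<Phi> \<nu> = u" by (auto simp: Rot_def)
  have "(1 - t) * (r / d) = t" using r \<open>0 < d\<close> by (simp add: t_def field_simps)
  then have "t *\<^sub>R rv \<Phi> \<mu> + (1 - t) *\<^sub>R u = v"
    unfolding u_def scaleR_add_right scaleR_scaleR by (simp add: algebra_simps)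
  then have "rv \<Phi> (mix_measure t \<mu> \<nu>) = v"
    by (simp add: rv_mix_measure[OF t \<mu> \<nu>(1)] \<nu>(2))
  then have "measure_entropy f (mix_measure t \<mu> \<nu>) \<le> localized_entropy f \<Phi> v"
    unfolding localized_entropy_def
    using mix_measure_invariant[OF t f \<mu> \<nu>(1)] by (intro SUP_upper) auto
  then have "ereal (1 / t) * measure_entropy f (mix_measure t \<mu> \<nu>) \<le> ereal (1 / t) * localized_entropy f \<Phi> v"
    using t by (intro ereal_mult_left_mono) auto
  moreover have "1 / t = 1 + d / r" using r by (simp add: t_def field_simps)
  ultimately show ?thesis using measure_entropy_le_mix_measure[OF t f \<mu> \<nu>(1)] by simp
qed

text \<open>Replacing \<Phi> by \<Psi> moves the rotation vector of any measure by at most the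
  distance of the potentials, and w is a further \<open>dist w v\<close> away from v. Only the
  target pair needs a ball inside its rotation set.\<close>

lemma localized_entropy_le:
  fixes \<Phi> \<Psi> :: "'a::topological_space \<Rightarrow>\<^sub>C (real ^ 'm)"
  assumes f: "f \<in> borel \<rightarrow>\<^sub>M borel" and r: "0 < r" and ball: "cball v r \<subseteq> Rot f \<Psi>"
  shows "localized_entropy f \<Phi> w \<le> ereal (1 + sum_dist (\<Phi>, w) (\<Psi>, v) / r) * localized_entropy f \<Psi> v"
  unfolding localized_entropy_def[of f \<Phi> w]
proof (rule SUP_least)
  fix \<mu> assume "\<mu> \<in> {\<mu> \<in> invariant_measures f. rv \<Phi> \<mu> = w}"
  then have \<mu>: "\<mu> \<in> invariant_measures f" and w: "rv \<Phi> \<mu> = w" by auto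
  have "dist (rv \<Psi> \<mu>) v \<le> sum_dist (\<Phi>, w) (\<Psi>, v)"
    using dist_triangle[of "rv \<Psi> \<mu>" v w] w dist_rv_le[OF invariant_measuresD(1,2)[OF \<mu>], of \<Psi> \<Phi>]
    by (simp add: sum_dist_def dist_commute)
  then show "measure_entropy f \<mu> \<le> ereal (1 + sum_dist (\<Phi>, w) (\<Psi>, v) / r) * localized_entropy f \<Psi> v"
    by (rule measure_entropy_le_localized_entropy[OF f r ball \<mu>])
qed

section \<open>The sum metric and the continuity of the global entropy function\<close>

text \<open>The two metrics are equivalent,
  \<open>dist p q \<le> sum_dist p q \<le> 2 * dist p q\<close>, so continuity can be proved with
  the usual filters on the product type.\<close>

lemma mtopology_sum_dist:
  "Metric_space.mtopology UNIV (sum_dist :: 'b::metric_space \<times> 'c::metric_space \<Rightarrow> _) = euclidean"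
proof -
  interpret Metric_space UNIV "sum_dist :: 'b \<times> 'c \<Rightarrow> _" by (rule Metric_space_sum_dist)
  have le: "dist p q \<le> sum_dist p q" for p q :: "'b \<times> 'c"
    unfolding dist_prod_def sum_dist_def by (rule sqrt_sum_squares_le_sum) auto
  have ge: "sum_dist p q \<le> 2 * dist p q" for p q :: "'b \<times> 'c"
    using dist_fst_le[of p q] dist_snd_le[of p q] by (simp add: sum_dist_def)
  show ?thesis unfolding topology_eq openin_mtopology open_openin[symmetric] open_dist
  proof (intro allI iffI conjI ballI impI subset_UNIV)
    fix U :: "('b \<times> 'c) set" and p
    assume "U \<subseteq> UNIV \<and> (\<forall>p. p \<in> U \<longrightarrow> (\<exists>r>0. mball p r \<subseteq> U))" "p \<in> U"
    then obtain r where r: "r > 0" "mball p r \<subseteq> U" by blast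
    have "q \<in> U" if "dist q p < r / 2" for q
      using ge[of p q] that r(2) by (auto simp: dist_commute)
    with r(1) show "\<exists>e>0. \<forall>q. dist q p < e \<longrightarrow> q \<in> U"
      by (intro exI[of _ "r / 2"]) simp
  next
    fix U :: "('b \<times> 'c) set" and p
    assume "\<forall>p\<in>U. \<exists>e>0. \<forall>q. dist q p < e \<longrightarrow> q \<in> U" "p \<in> U"
    then obtain e where e: "e > 0" "\<forall>q. dist q p < e \<longrightarrow> q \<in> U" by blast
    have "q \<in> U" if "sum_dist p q < e" for q
      using e(2) le_less_trans[OF le that] by (metis dist_commute)
    with e(1) show "\<exists>r>0. mball p r \<subseteq> U"
      by (intro exI[of _ e]) auto
  qed
qed

theorem theorem4p5:
  fixes f :: "'a::metric_space \<Rightarrow> 'a"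
  assumes "compact (UNIV :: 'a set)"
    and "continuous_on UNIV f"
    and "topological_entropy f < \<infinity>"
    and "upper_semicontinuous_map (weak_star_topology f) (measure_entropy f)"
  shows "continuous_map
           (subtopology (Metric_space.mtopology UNIV sum_dist)
              (\<Union>\<Phi> :: 'a \<Rightarrow>\<^sub>C (real ^ 'm). {\<Phi>} \<times> interior (Rot f \<Phi>)))
           euclidean
           (\<lambda>(\<Phi>, w). localized_entropy f \<Phi> w)"
  unfolding mtopology_sum_dist continuous_map_iff_continuous continuous_on_def
proof (intro ballI)
  let ?S = "\<Union>\<Phi> :: 'a \<Rightarrow>\<^sub>C (real ^ 'm). {\<Phi>} \<times> interior (Rot f \<Phi>)"
  let ?H = "\<lambda>(\<Phi> :: 'a \<Rightarrow>\<^sub>C (real ^ 'm), w). localized_entropy f \<Phi> w"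
  fix p assume "p \<in> ?S"
  then obtain \<Phi> w where p: "p = (\<Phi>, w)" and w: "w \<in> interior (Rot f \<Phi>)" by auto
  have f: "f \<in> borel \<rightarrow>\<^sub>M borel"
    using assms(2) by (rule borel_measurable_continuous_onI)
  from w obtain e where e: "e > 0" "cball w e \<subseteq> Rot f \<Phi>"
    by (auto simp: mem_interior_cball)
  \<comment> \<open>A third of the radius is what \<open>cball_subset_Rot_perturb\<close> leaves
    around nearby pairs.\<close>
  define r where "r = e / 3"
  have r: "r > 0" and ball: "cball w (3 * r) \<subseteq> Rot f \<Phi>" using e by (auto simp: r_def)
  have ball_w: "cball w r \<subseteq> Rot f \<Phi>"
    using ball r subset_cball[of r "3 * r" w] by simp
  have H0: "0 \<le> ?H p"
    using localized_entropy_nonneg[OF f subsetD[OF ball_w, of w]] r p by simp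
  let ?k = "\<lambda>q. 1 + sum_dist p q / r"
  have "((\<lambda>q. sum_dist p q) \<longlongrightarrow> sum_dist p p) (at p within ?S)"
    unfolding sum_dist_def by (intro tendsto_intros)
  then have k: "(?k \<longlongrightarrow> 1) (at p within ?S)" "((\<lambda>q. 1 / ?k q) \<longlongrightarrow> 1) (at p within ?S)"
    using r by (auto intro!: tendsto_eq_intros simp: sum_dist_def)
  have near: "eventually (\<lambda>q. sum_dist p q < r) (at p within ?S)"
    using \<open>((\<lambda>q. sum_dist p q) \<longlongrightarrow> sum_dist p p) _\<close> r
    by (intro order_tendstoD(2)) (auto simp: sum_dist_def)
  \<comment> \<open>The target is the fixed pair \<open>p\<close>, whose ball is available, so the
    bound holds for every \<open>q\<close>.\<close>
  have upper: "?H q \<le> ereal (?k q) * ?H p" for q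
    using localized_entropy_le[OF f r ball_w, of "fst q" "snd q"]
    by (simp add: p case_prod_unfold sum_dist_def dist_commute)
  \<comment> \<open>Here the roles are exchanged and the target is \<open>q\<close>. The
    perturbation lemma supplies a ball of the same radius \<open>r\<close> in its rotation set, so
    the same factor \<open>?k q\<close> appears.\<close>
  have lower: "ereal (1 / ?k q) * ?H p \<le> ?H q" if "sum_dist p q < r" for q
  proof -
    have "dist \<Phi> (fst q) < r" "dist w (snd q) < r"
      using that zero_le_dist[of \<Phi> "fst q"] zero_le_dist[of w "snd q"]
      by (simp_all add: p sum_dist_def del: zero_le_dist)
    from localized_entropy_le[OF f r cball_subset_Rot_perturb[OF f r ball this], of \<Phi> w]
    have le: "?H p \<le> ereal (?k q) * ?H q" by (simp add: p case_prod_unfold)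
    have pos: "0 < ?k q" using r by (simp add: sum_dist_def add_pos_nonneg)
    have "ereal (1 / ?k q) * ?H p \<le> ereal (1 / ?k q) * (ereal (?k q) * ?H q)"
      using le pos by (intro ereal_mult_left_mono) auto
    also have "\<dots> = ?H q"
      using pos by (simp add: mult.assoc[symmetric])
    finally show ?thesis .
  qed
  show "(?H \<longlongrightarrow> ?H p) (at p within ?S)"
  proof (rule tendsto_sandwich)
    show "eventually (\<lambda>q. ereal (1 / ?k q) * ?H p \<le> ?H q) (at p within ?S)"
      using near by eventually_elim (rule lower)
    show "eventually (\<lambda>q. ?H q \<le> ereal (?k q) * ?H p) (at p within ?S)"
      using upper by simp
    \<comment> \<open>Multiplication in \<open>ereal\<close> fails to be continuous only where 0
      meets an infinite value, and here the first factor tends to 1.\<close>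
    have "((\<lambda>q. ereal (g q) * ?H p) \<longlongrightarrow> ?H p) (at p within ?S)"
      if "(g \<longlongrightarrow> 1) (at p within ?S)" for g :: "_ \<Rightarrow> real"
      using tendsto_mult_ereal[OF tendsto_ereal[OF that] tendsto_const, of "?H p"] by simp
    then show "((\<lambda>q. ereal (1 / ?k q) * ?H p) \<longlongrightarrow> ?H p) (at p within ?S)"
      "((\<lambda>q. ereal (?k q) * ?H p) \<longlongrightarrow> ?H p) (at p within ?S)"
      using k by blast+
  qed
qed

end
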